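(* Let $\rho^{\bm u}_{\mathrm{opt}}:[t_0,t_1]\times\mathbb{R}^n\to(0,\infty)$ and $S:[t_0,t_1]\times\mathbb{R}^n\to\mathbb{R}$ be as in the context, and define $$R:=\tfrac12\log\rho^{\bm u}_{\mathrm{opt}},\qquad\psi:=\exp(R+\mathrm{i}S),\qquad\psi^{\dagger}:=\exp(R-\mathrm{i}S).$$ Then the system (the conditions of optimality for the Schrödinger bridge, i.e. the case of zero state cost, zero drift, and identity input and noise coefficients) $$\partial_t\rho^{\bm u}_{\mathrm{opt}}+\nabla_{\bm x}\cdot\left(\rho^{\bm u}_{\mathrm{opt}}\nabla_{\bm x}S\right)=\tfrac12\Delta_{\bm x}\rho^{\bm u}_{\mathrm{opt}},$$ $$\partial_tS+\tfrac12\|\nabla_{\bm x}S\|^2+\tfrac12\Delta_{\bm x}S=0,$$ $$\rho^{\bm u}_{\mathrm{opt}}(t_0,\cdot)=\rho_0(\cdot),\qquad\rho^{\bm u}_{\mathrm{opt}}(t_1,\cdot)=\rho_1(\cdot),$$ is equivalent to the boundary value problem for $\psi$ $$\mathrm{i}\,\partial_t\psi=-\tfrac12\Delta_{\bm x}\psi+V_{\mathrm{SB}}\,\psi,$$ $$\psi(t_0,\bm x)\psi^{\dagger}(t_0,\bm x)=\rho_0(\bm x),\qquad\psi(t_1,\bm x)\psi^{\dagger}(t_1,\bm x)=\rho_1(\bm x),$$ where the complex-valued potential $V_{\mathrm{SB}}$ (which depends on $\psi$ through $R$ and $S$) has real and imaginary parts $$\Re(V_{\mathrm{SB}})=\tfrac12\Delta_{\bm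 x}R+\tfrac12\|\nabla_{\bm x}R\|^2+\tfrac12\Delta_{\bm x}S,\qquad\Im(V_{\mathrm{SB}})=\tfrac12\Delta_{\bm x}R+\|\nabla_{\bm x}R\|^2.$$
   Context: Fix a time horizon $[t_0,t_1]$ and probability density functions $\rho_0,\rho_1$ on $\mathbb{R}^n$ with finite second moments. The function $\rho^{\bm u}_{\mathrm{opt}}$ is real-valued and strictly positive, with each $\rho^{\bm u}_{\mathrm{opt}}(t,\cdot)$ a probability density on $\mathbb{R}^n$; both $\rho^{\bm u}_{\mathrm{opt}}$ and the real-valued function $S$ are once continuously differentiable in $t$ and twice continuously differentiable in $\bm x$, and the equations are understood pointwise. "Equivalent" means that $(\rho^{\bm u}_{\mathrm{opt}},S)$ satisfies the first system if and only if $\psi$ satisfies the boundary value problem with the stated potential. Notation: $\mathrm{i}=\sqrt{-1}$; $\nabla_{\bm x}$, $\nabla_{\bm x}\cdot$, $\Delta_{\bm x}$ are the standard Euclidean gradient, divergence and Laplacian in $\bm x$; $\|\cdot\|$ is the Euclidean norm. *)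

theory Defs
  imports "HOL-Analysis.Analysis"
begin

definition partial_deriv :: "'n::finite \<Rightarrow> (real^'n \<Rightarrow> 'b::real_normed_vector) \<Rightarrow> real^'n \<Rightarrow> 'b"
  where "partial_deriv i f x = vector_derivative (\<lambda>h. f (x + h *\<^sub>R axis i 1)) (at 0)"

definition has_partial_derivs :: "(real^'n::finite \<Rightarrow> 'b::real_normed_vector) \<Rightarrow> bool"
  where "has_partial_derivs f \<longleftrightarrow> (\<forall>i x. (\<lambda>h. f (x + h *\<^sub>R axis i 1)) differentiable (at 0))"

definition gradient :: "(real^'n::finite \<Rightarrow> real) \<Rightarrow> real^'n \<Rightarrow> real^'n"
  where "gradient f x = (\<chi> i. partial_deriv i f x)"

definition divergence :: "(real^'n::finite \<Rightarrow> real^'n) \<Rightarrow> real^'n \<Rightarrow> real"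
  where "divergence F x = (\<Sum>i\<in>UNIV. partial_deriv i (\<lambda>y. F y $ i) x)"

definition laplacian :: "(real^'n::finite \<Rightarrow> 'b::real_normed_vector) \<Rightarrow> real^'n \<Rightarrow> 'b"
  where "laplacian f x = (\<Sum>i\<in>UNIV. partial_deriv i (partial_deriv i f) x)"

text \<open>The time derivative is taken within the closed horizon, so it is one-sided at the two
  endpoints and does not depend on values outside the horizon.\<close>

definition time_deriv ::
    "real \<Rightarrow> real \<Rightarrow> (real \<Rightarrow> real^'n::finite \<Rightarrow> 'b::real_normed_vector) \<Rightarrow> real \<Rightarrow> real^'n \<Rightarrow> 'b"
  where "time_deriv t0 t1 f t x = vector_derivative (\<lambda>s. f s x) (at t within {t0..t1})"

definition C1_on_horizon :: "real \<Rightarrow> real \<Rightarrow> (real \<Rightarrow> real) \<Rightarrow> bool"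
  where "C1_on_horizon t0 t1 g \<longleftrightarrow>
    (\<forall>t\<in>{t0..t1}. g differentiable (at t within {t0..t1})) \<and>
    continuous_on {t0..t1} (\<lambda>t. vector_derivative g (at t within {t0..t1}))"

definition C2_space :: "(real^'n::finite \<Rightarrow> real) \<Rightarrow> bool"
  where "C2_space f \<longleftrightarrow>
    continuous_on UNIV f \<and> has_partial_derivs f \<and>
    (\<forall>i. continuous_on UNIV (partial_deriv i f) \<and> has_partial_derivs (partial_deriv i f)) \<and>
    (\<forall>i j. continuous_on UNIV (partial_deriv j (partial_deriv i f)))"

text \<open>Regularity is required separately in each variable; no joint continuity in time and space
  is imposed.\<close>

definition C1_time_C2_space :: "real \<Rightarrow> real \<Rightarrow> (real \<Rightarrow> real^'n::finite \<Rightarrow> real) \<Rightarrow> bool"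
  where "C1_time_C2_space t0 t1 f \<longleftrightarrow>
    (\<forall>x. C1_on_horizon t0 t1 (\<lambda>t. f t x)) \<and> (\<forall>t\<in>{t0..t1}. C2_space (f t))"

definition prob_density :: "(real^'n::finite \<Rightarrow> real) \<Rightarrow> bool"
  where "prob_density p \<longleftrightarrow>
    (\<forall>x. 0 \<le> p x) \<and> integrable lborel p \<and> integral\<^sup>L lborel p = 1"

definition finite_second_moment :: "(real^'n::finite \<Rightarrow> real) \<Rightarrow> bool"
  where "finite_second_moment p \<longleftrightarrow> integrable lborel (\<lambda>x. (norm x)\<^sup>2 * p x)"

definition bridge_optimality_system ::
    "real \<Rightarrow> real \<Rightarrow> (real^'n::finite \<Rightarrow> real) \<Rightarrow> (real^'n \<Rightarrow> real) \<Rightarrow>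
     (real \<Rightarrow> real^'n \<Rightarrow> real) \<Rightarrow> (real \<Rightarrow> real^'n \<Rightarrow> real) \<Rightarrow> bool"
  where "bridge_optimality_system t0 t1 \<rho>0 \<rho>1 \<rho> S \<longleftrightarrow>
    (\<forall>t\<in>{t0..t1}. \<forall>x.
       time_deriv t0 t1 \<rho> t x + divergence (\<lambda>y. \<rho> t y *\<^sub>R gradient (S t) y) x
         = 1/2 * laplacian (\<rho> t) x) \<and>
    (\<forall>t\<in>{t0..t1}. \<forall>x.
       time_deriv t0 t1 S t x + 1/2 * (norm (gradient (S t) x))\<^sup>2 + 1/2 * laplacian (S t) x = 0) \<and>
    (\<forall>x. \<rho> t0 x = \<rho>0 x) \<and> (\<forall>x. \<rho> t1 x = \<rho>1 x)"

definition V_SB ::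
    "(real \<Rightarrow> real^'n::finite \<Rightarrow> real) \<Rightarrow> (real \<Rightarrow> real^'n \<Rightarrow> real) \<Rightarrow> real \<Rightarrow> real^'n \<Rightarrow> complex"
  where "V_SB R S t x = Complex
    (1/2 * laplacian (R t) x + 1/2 * (norm (gradient (R t) x))\<^sup>2 + 1/2 * laplacian (S t) x)
    (1/2 * laplacian (R t) x + (norm (gradient (R t) x))\<^sup>2)"

definition schroedinger_bvp ::
    "real \<Rightarrow> real \<Rightarrow> (real^'n::finite \<Rightarrow> real) \<Rightarrow> (real^'n \<Rightarrow> real) \<Rightarrow>
     (real \<Rightarrow> real^'n \<Rightarrow> complex) \<Rightarrow>
     (real \<Rightarrow> real^'n \<Rightarrow> complex) \<Rightarrow> (real \<Rightarrow> real^'n \<Rightarrow> complex) \<Rightarrow> bool"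
  where "schroedinger_bvp t0 t1 \<rho>0 \<rho>1 V \<psi> \<psi>d \<longleftrightarrow>
    (\<forall>t\<in>{t0..t1}. \<forall>x.
       \<i> * time_deriv t0 t1 \<psi> t x = - (1/2) * laplacian (\<psi> t) x + V t x * \<psi> t x) \<and>
    (\<forall>x. \<psi> t0 x * \<psi>d t0 x = of_real (\<rho>0 x)) \<and>
    (\<forall>x. \<psi> t1 x * \<psi>d t1 x = of_real (\<rho>1 x))"

end

theory Submission
  imports Defs
begin

text \<open>Write \<open>\<psi> = exp w\<close> with \<open>w = R + \<i> S\<close>. Differentiating an exponential twice gives
  \<open>\<Delta>\<psi> = (\<Delta>w + \<Sum>\<^sub>i (\<partial>\<^sub>i w)\<^sup>2) \<psi>\<close> and \<open>\<partial>\<^sub>t \<psi> = (\<partial>\<^sub>t w) \<psi>\<close>, where the square is the complex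
  square, so that its real part is \<open>\<parallel>\<nabla>R\<parallel>\<^sup>2 - \<parallel>\<nabla>S\<parallel>\<^sup>2\<close> and its imaginary part is
  \<open>2 \<nabla>R \<bullet> \<nabla>S\<close>. As \<open>\<psi>\<close> never vanishes, it can be divided out of the Schroedinger equation, which
  leaves two real equations. The terms in \<open>R\<close> of the real part cancel against the real part of
  the potential, and what remains is the Hamilton-Jacobi equation for \<open>S\<close>. The imaginary part reads
  \<open>\<partial>\<^sub>t R + \<nabla>R \<bullet> \<nabla>S + 1/2 \<Delta>S = 1/2 \<Delta>R + \<parallel>\<nabla>R\<parallel>\<^sup>2\<close>.

  The same exponential identity, applied to \<open>\<rho> = exp (2 R)\<close>, turns the Fokker-Planck equation
  into \<open>2 \<rho>\<close> times this last equation, and \<open>\<rho> > 0\<close>. So the two pairs of equations agree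
  separately at every point. The boundary conditions agree because
  \<open>\<psi> \<psi>\<^sup>\<dagger> = exp (2 R) = \<rho>\<close>.

  The exponential identity is \<open>laplacian_exp\<close>, stated for real and complex exponents at once; the
  comparison at a point is the algebra in \<open>schroedinger_pointwise_iff\<close> and \<open>fokker_planck_log\<close>.\<close>

section \<open>Calculus of partial derivatives\<close>

definition has_partial ::
    "'n::finite \<Rightarrow> (real^'n \<Rightarrow> 'b::real_normed_vector) \<Rightarrow> 'b \<Rightarrow> real^'n \<Rightarrow> bool"
  where "has_partial i f d x \<longleftrightarrow> ((\<lambda>h. f (x + h *\<^sub>R axis i 1)) has_vector_derivative d) (at 0)"

lemma has_partial_imp_partial_deriv: "has_partial i f d x \<Longrightarrow> partial_deriv i f x = d"
  unfolding has_partial_def partial_deriv_def by (rule vector_derivative_at)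

lemma has_partial_derivs_iff:
  "has_partial_derivs f \<longleftrightarrow> (\<forall>i x. has_partial i f (partial_deriv i f x) x)"
  unfolding has_partial_derivs_def has_partial_def partial_deriv_def
  by (simp add: vector_derivative_works)

lemma has_partial_derivsI:
  assumes "\<And>i x. has_partial i f (d i x) x"
  shows "has_partial_derivs f"
  unfolding has_partial_derivs_iff using assms has_partial_imp_partial_deriv by metis

lemma has_partial_derivsD:
  "has_partial_derivs f \<Longrightarrow> has_partial i f (partial_deriv i f x) x"
  by (simp add: has_partial_derivs_iff)

lemma has_partial_add:
  "has_partial i f a x \<Longrightarrow> has_partial i g b x \<Longrightarrow> has_partial i (\<lambda>y. f y + g y) (a + b) x"
  unfolding has_partial_def by (rule has_vector_derivative_add)

lemma has_partial_bounded_linear: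
  "bounded_linear L \<Longrightarrow> has_partial i f a x \<Longrightarrow> has_partial i (\<lambda>y. L (f y)) (L a) x"
  unfolding has_partial_def by (rule bounded_linear.has_vector_derivative)

lemma has_partial_mult:
  fixes f g :: "real^'n::finite \<Rightarrow> 'b::real_normed_algebra"
  assumes "has_partial i f a x" "has_partial i g b x"
  shows "has_partial i (\<lambda>y. f y * g y) (f x * b + a * g x) x"
  using has_vector_derivative_mult[OF assms[unfolded has_partial_def]]
  by (simp add: has_partial_def)

lemma has_partial_chain:
  fixes f :: "real^'n::finite \<Rightarrow> 'b::real_normed_field"
  assumes "has_partial i f a x" "(g has_field_derivative g') (at (f x))"
  shows "has_partial i (\<lambda>y. g (f y)) (a * g') x"
  using field_vector_diff_chain_at[OF assms(1)[unfolded has_partial_def], of g g'] assms(2)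
  by (simp add: has_partial_def o_def)

section \<open>Functions with two partial derivatives\<close>

text \<open>The identities below hold pointwise and rest on existence of derivatives alone. Asking for
  existence, pure and mixed, gives a class closed under logarithms, sums and bounded linear maps
  by the differentiation rules of one variable, so that \<open>R\<close> and \<open>R + \<i> S\<close> inherit it from
  \<open>\<rho>\<close> and \<open>S\<close>.\<close>

definition twice_partial :: "(real^'n::finite \<Rightarrow> 'b::real_normed_vector) \<Rightarrow> bool"
  where "twice_partial f \<longleftrightarrow> has_partial_derivs f \<and> (\<forall>i. has_partial_derivs (partial_deriv i f))"

lemma C2_space_imp_twice_partial: "C2_space f \<Longrightarrow> twice_partial f"
  by (simp add: C2_space_def twice_partial_def)

lemma twice_partialD:
  assumes "twice_partial f"
  shows "has_partial i f (partial_deriv i f x) x"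
    and "has_partial j (partial_deriv i f) (partial_deriv j (partial_deriv i f) x) x"
  using assms by (simp_all add: twice_partial_def has_partial_derivsD)

text \<open>A second partial derivative is a partial derivative of the function \<open>partial_deriv i f\<close>, so
  computing it requires the first partial derivatives at all points.\<close>

lemma second_partials:
  assumes "\<And>i x. has_partial i f (d i x) x" "\<And>i j x. has_partial j (d i) (e j i x) x"
  shows "twice_partial f" "partial_deriv i f = d i"
    "partial_deriv j (partial_deriv i f) x = e j i x"
proof -
  have *: "partial_deriv i f = d i" for i
    using has_partial_imp_partial_deriv[OF assms(1)] by (rule ext)
  then show "partial_deriv i f = d i" .
  show "twice_partial f"
    unfolding twice_partial_def *
    by (intro conjI allI) (rule has_partial_derivsI, rule assms)+
  show "partial_deriv j (partial_deriv i f) x = e j i x"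
    unfolding * by (rule has_partial_imp_partial_deriv[OF assms(2)])
qed

lemma twice_partial_ln:
  fixes f :: "real^'n::finite \<Rightarrow> real"
  assumes "twice_partial f" "\<And>x. 0 < f x"
  shows "twice_partial (\<lambda>x. ln (f x))"
proof (rule second_partials(1))
  show "has_partial i (\<lambda>x. ln (f x)) (partial_deriv i f x * inverse (f x)) x" for i x
    using has_partial_chain[OF twice_partialD(1)[OF assms(1)] DERIV_ln[OF assms(2)]] .
  have "has_partial j (\<lambda>x. inverse (f x)) (partial_deriv j f x * (- (inverse (f x) ^ 2))) x" for j x
    by (rule has_partial_chain[OF twice_partialD(1)[OF assms(1)]])
      (use assms(2)[of x] DERIV_inverse[of "f x" UNIV] in \<open>simp add: numeral_2_eq_2\<close>)
  then show "has_partial j (\<lambda>x. partial_deriv i f x * inverse (f x))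
      (partial_deriv i f x * (partial_deriv j f x * (- (inverse (f x) ^ 2)))
        + partial_deriv j (partial_deriv i f) x * inverse (f x)) x" for i j x
    by (rule has_partial_mult[OF twice_partialD(2)[OF assms(1)]])
qed

lemma second_partials_bounded_linear:
  assumes "bounded_linear L" "twice_partial f"
  shows "twice_partial (\<lambda>x. L (f x))"
    and "partial_deriv i (\<lambda>x. L (f x)) x = L (partial_deriv i f x)"
    and "laplacian (\<lambda>x. L (f x)) x = L (laplacian f x)"
proof -
  note * = second_partials[of "\<lambda>x. L (f x)" "\<lambda>i x. L (partial_deriv i f x)"
      "\<lambda>j i x. L (partial_deriv j (partial_deriv i f) x)",
      OF has_partial_bounded_linear[OF assms(1) twice_partialD(1)[OF assms(2)]]
         has_partial_bounded_linear[OF assms(1) twice_partialD(2)[OF assms(2)]]]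
  show "twice_partial (\<lambda>x. L (f x))" by (rule *(1))
  show "partial_deriv i (\<lambda>x. L (f x)) x = L (partial_deriv i f x)" by (simp add: *(2))
  show "laplacian (\<lambda>x. L (f x)) x = L (laplacian f x)"
    unfolding laplacian_def *(3)
    by (simp add: linear_sum[OF bounded_linear.linear[OF assms(1)]])
qed

lemma second_partials_add:
  assumes "twice_partial f" "twice_partial g"
  shows "twice_partial (\<lambda>x. f x + g x)"
    and "partial_deriv i (\<lambda>x. f x + g x) x = partial_deriv i f x + partial_deriv i g x"
    and "laplacian (\<lambda>x. f x + g x) x = laplacian f x + laplacian g x"
proof -
  note * = second_partials[of "\<lambda>x. f x + g x" "\<lambda>i x. partial_deriv i f x + partial_deriv i g x"
      "\<lambda>j i x. partial_deriv j (partial_deriv i f) x + partial_deriv j (partial_deriv i g) x",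
      OF has_partial_add[OF twice_partialD(1)[OF assms(1)] twice_partialD(1)[OF assms(2)]]
         has_partial_add[OF twice_partialD(2)[OF assms(1)] twice_partialD(2)[OF assms(2)]]]
  show "twice_partial (\<lambda>x. f x + g x)" by (rule *(1))
  show "partial_deriv i (\<lambda>x. f x + g x) x = partial_deriv i f x + partial_deriv i g x"
    by (simp add: *(2))
  show "laplacian (\<lambda>x. f x + g x) x = laplacian f x + laplacian g x"
    unfolding laplacian_def *(3) by (simp add: sum.distrib)
qed

lemma has_partial_exp:
  fixes f :: "real^'n::finite \<Rightarrow> 'b::{real_normed_field,banach}"
  assumes "has_partial i f a x"
  shows "has_partial i (\<lambda>x. exp (f x)) (a * exp (f x)) x"
  using has_partial_chain[OF assms DERIV_exp] .

text \<open>Differentiating \<open>\<partial>\<^sub>i f exp f\<close> once more produces the square of \<open>\<partial>\<^sub>i f\<close>. It is a square in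
  the field, not of a norm: for \<open>f = R + \<i> S\<close> this is the source of the term
  \<open>2 \<i> \<nabla>R \<bullet> \<nabla>S\<close>, while \<open>f = 2 R\<close> is the real case used for the density.\<close>

lemma laplacian_exp:
  fixes f :: "real^'n::finite \<Rightarrow> 'b::{real_normed_field,banach}"
  assumes "twice_partial f"
  shows "laplacian (\<lambda>x. exp (f x)) x
    = (laplacian f x + (\<Sum>i\<in>UNIV. (partial_deriv i f x)\<^sup>2)) * exp (f x)"
proof -
  note first = twice_partialD(1)[OF assms] and second = twice_partialD(2)[OF assms]
  have "partial_deriv i (partial_deriv i (\<lambda>x. exp (f x))) x
      = partial_deriv i f x * (partial_deriv i f x * exp (f x))
        + partial_deriv i (partial_deriv i f) x * exp (f x)" for i
    by (rule second_partials(3)[where e = "\<lambda>j i x. partial_deriv i f x * (partial_deriv j f x * exp (f x))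
        + partial_deriv j (partial_deriv i f) x * exp (f x)",
        OF has_partial_exp[OF first] has_partial_mult[OF second has_partial_exp[OF first]]])
  then show ?thesis
    unfolding laplacian_def
    by (simp add: sum_distrib_left sum.distrib algebra_simps power2_eq_square)
qed

lemma norm_gradient_square: "(norm (gradient f x))\<^sup>2 = (\<Sum>i\<in>UNIV. (partial_deriv i f x)\<^sup>2)"
  by (simp add: gradient_def norm_vec_def L2_set_def sum_nonneg)

lemma inner_gradient:
  "gradient f x \<bullet> gradient g x = (\<Sum>i\<in>UNIV. partial_deriv i f x * partial_deriv i g x)"
  by (simp add: gradient_def inner_vec_def)

lemma divergence_scaleR_gradient:
  assumes "has_partial_derivs f" "twice_partial g"
  shows "divergence (\<lambda>y. f y *\<^sub>R gradient g y) x
    = gradient f x \<bullet> gradient g x + f x * laplacian g x"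
proof -
  have "partial_deriv i (\<lambda>y. f y * partial_deriv i g y) x
      = f x * partial_deriv i (partial_deriv i g) x + partial_deriv i f x * partial_deriv i g x" for i
    by (rule has_partial_imp_partial_deriv
        [OF has_partial_mult[OF has_partial_derivsD[OF assms(1)] twice_partialD(2)[OF assms(2)]]])
  then show ?thesis
    by (simp add: divergence_def gradient_def inner_vec_def laplacian_def sum.distrib sum_distrib_left)
qed

section \<open>The two pairs of equations at a point\<close>

lemma laplacian_wave:
  fixes r s :: "real^'n::finite \<Rightarrow> real"
  assumes r: "twice_partial r" and s: "twice_partial s"
  shows "laplacian (\<lambda>x. exp (complex_of_real (r x) + \<i> * complex_of_real (s x))) x
    = Complex (laplacian r x + (norm (gradient r x))\<^sup>2 - (norm (gradient s x))\<^sup>2)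
        (laplacian s x + 2 * (gradient r x \<bullet> gradient s x))
      * exp (complex_of_real (r x) + \<i> * complex_of_real (s x))"
proof -
  let ?w = "\<lambda>x. complex_of_real (r x) + \<i> * complex_of_real (s x)"
  have lin: "bounded_linear (\<lambda>a. \<i> * complex_of_real a)"
    by (rule bounded_linear_compose[OF bounded_linear_mult_right bounded_linear_of_real])
  note re = second_partials_bounded_linear[OF bounded_linear_of_real[where 'a = complex] r]
  note im = second_partials_bounded_linear[OF lin s]
  note sum = second_partials_add[OF re(1) im(1)]
  have "(\<Sum>i\<in>UNIV. (partial_deriv i ?w x)\<^sup>2)
      = Complex ((norm (gradient r x))\<^sup>2 - (norm (gradient s x))\<^sup>2)
          (2 * (gradient r x \<bullet> gradient s x))"
    unfolding sum(2) re(2) im(2)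
    unfolding norm_gradient_square
    by (simp add: complex_eq_iff inner_gradient sum_subtractf sum_distrib_left mult_ac
        power2_eq_square)
  moreover have "laplacian ?w x = Complex (laplacian r x) (laplacian s x)"
    unfolding sum(3) re(3) im(3) by (simp add: complex_eq_iff)
  ultimately show ?thesis
    unfolding laplacian_exp[OF sum(1)] by (simp add: complex_add)
qed

text \<open>The real numbers \<open>r'\<close> and \<open>s'\<close> stand for the time derivatives of amplitude exponent and
  phase. After division by the wave function, the real and imaginary parts of the
  Schroedinger equation are the Hamilton-Jacobi equation and the logarithmic Fokker-Planck
  equation.\<close>

lemma schroedinger_pointwise_iff:
  fixes R S :: "real \<Rightarrow> real^'n::finite \<Rightarrow> real" and x :: "real^'n"
  assumes "twice_partial (R t)" "twice_partial (S t)"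
  defines "z \<equiv> exp (complex_of_real (R t x) + \<i> * complex_of_real (S t x))"
  shows "\<i> * (Complex r' s' * z)
      = - (1/2) * laplacian (\<lambda>x. exp (complex_of_real (R t x) + \<i> * complex_of_real (S t x))) x
        + V_SB R S t x * z
    \<longleftrightarrow>
    r' + gradient (R t) x \<bullet> gradient (S t) x + 1/2 * laplacian (S t) x
      = 1/2 * laplacian (R t) x + (norm (gradient (R t) x))\<^sup>2
    \<and> s' + 1/2 * (norm (gradient (S t) x))\<^sup>2 + 1/2 * laplacian (S t) x = 0"
    (is "?schroedinger \<longleftrightarrow> ?real")
proof -
  define L where "L = Complex
      (laplacian (R t) x + (norm (gradient (R t) x))\<^sup>2 - (norm (gradient (S t) x))\<^sup>2)
      (laplacian (S t) x + 2 * (gradient (R t) x \<bullet> gradient (S t) x))"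
  have "?schroedinger \<longleftrightarrow> (\<i> * Complex r' s') * z = (- (1/2) * L + V_SB R S t x) * z"
    unfolding laplacian_wave[OF assms(1,2)] L_def z_def by (simp add: algebra_simps)
  also have "\<dots> \<longleftrightarrow> \<i> * Complex r' s' = - (1/2) * L + V_SB R S t x"
    by (simp add: z_def)
  also have "\<dots> \<longleftrightarrow> ?real"
    unfolding complex_eq_iff L_def V_SB_def by (auto simp: field_simps)
  finally show ?thesis .
qed

text \<open>With \<open>\<rho> = exp (2 r)\<close> every term of the Fokker-Planck equation carries the positive factor
  \<open>2 \<rho>\<close>; dividing it out leaves an equation for the logarithm, with the extra quadratic term
  \<open>\<parallel>\<nabla>r\<parallel>\<^sup>2\<close> coming from the Laplacian of the exponential. Here \<open>2 r' \<rho>\<close> stands for the time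
  derivative of \<open>\<rho>\<close>.\<close>

lemma fokker_planck_log:
  fixes \<rho> s :: "real^'n::finite \<Rightarrow> real"
  assumes \<rho>: "twice_partial \<rho>" and s: "twice_partial s" and pos: "\<And>x. 0 < \<rho> x"
  defines "r \<equiv> \<lambda>x. 1/2 * ln (\<rho> x)"
  shows "twice_partial r"
    and "2 * r' * \<rho> x + divergence (\<lambda>y. \<rho> y *\<^sub>R gradient s y) x = 1/2 * laplacian \<rho> x
    \<longleftrightarrow> r' + gradient r x \<bullet> gradient s x + 1/2 * laplacian s x
        = 1/2 * laplacian r x + (norm (gradient r x))\<^sup>2"
proof -
  show r: "twice_partial r"
    unfolding r_def
    by (rule second_partials_bounded_linear(1)[OF bounded_linear_mult_right twice_partial_ln])
      (use \<rho> pos in auto)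
  note double = second_partials_bounded_linear[OF bounded_linear_mult_right[of 2] r]
  have \<rho>_exp: "\<rho> = (\<lambda>x. exp (2 * r x))"
    using pos by (simp add: r_def)
  have grad: "partial_deriv i \<rho> x = 2 * partial_deriv i r x * \<rho> x" for i
    by (subst (1 2) \<rho>_exp)
      (use has_partial_imp_partial_deriv[OF has_partial_exp[OF twice_partialD(1)[OF double(1)]]]
        in \<open>simp add: double(2)\<close>)
  have inner: "gradient \<rho> x \<bullet> gradient s x = 2 * \<rho> x * (gradient r x \<bullet> gradient s x)"
    by (simp add: inner_gradient grad sum_distrib_left mult_ac)
  have "laplacian (\<lambda>x. exp (2 * r x)) x
      = 2 * exp (2 * r x) * (laplacian r x + 2 * (norm (gradient r x))\<^sup>2)"
    unfolding laplacian_exp[OF double(1)] double(2,3) norm_gradient_square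
    by (simp add: power_mult_distrib sum_distrib_left algebra_simps)
  then have lap: "laplacian \<rho> x = 2 * \<rho> x * (laplacian r x + 2 * (norm (gradient r x))\<^sup>2)"
    unfolding \<rho>_exp[symmetric] using fun_cong[OF \<rho>_exp, of x] by simp
  have div: "divergence (\<lambda>y. \<rho> y *\<^sub>R gradient s y) x
      = 2 * \<rho> x * (gradient r x \<bullet> gradient s x) + \<rho> x * laplacian s x"
    using divergence_scaleR_gradient[OF _ s] \<rho> by (simp add: twice_partial_def inner)
  have "2 * r' * \<rho> x + divergence (\<lambda>y. \<rho> y *\<^sub>R gradient s y) x = 1/2 * laplacian \<rho> x
    \<longleftrightarrow> 2 * \<rho> x * (r' + gradient r x \<bullet> gradient s x + 1/2 * laplacian s x)
      = 2 * \<rho> x * (1/2 * laplacian r x + (norm (gradient r x))\<^sup>2)"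
    by (simp add: div lap algebra_simps)
  then show "2 * r' * \<rho> x + divergence (\<lambda>y. \<rho> y *\<^sub>R gradient s y) x = 1/2 * laplacian \<rho> x
    \<longleftrightarrow> r' + gradient r x \<bullet> gradient s x + 1/2 * laplacian s x
        = 1/2 * laplacian r x + (norm (gradient r x))\<^sup>2"
    using pos[of x] by (simp only: mult_cancel_left) simp
qed

section \<open>Time derivatives on the closed horizon\<close>

text \<open>On a nondegenerate interval one-sided derivatives at the endpoints are unique, which makes
  \<open>time_deriv\<close> computable there.\<close>

lemma time_deriv_eq:
  assumes "t0 < t1" "t \<in> {t0..t1}" "((\<lambda>s. f s x) has_vector_derivative d) (at t within {t0..t1})"
  shows "time_deriv t0 t1 f t x = d"
  unfolding time_deriv_def
  using vector_derivative_within_cbox[of t0 t1 t "\<lambda>s. f s x" d] assms by (simp add: cbox_interval)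

lemma C1_time_has_derivative:
  assumes "C1_time_C2_space t0 t1 f" "t \<in> {t0..t1}"
  shows "((\<lambda>s. f s x) has_vector_derivative time_deriv t0 t1 f t x) (at t within {t0..t1})"
  using assms unfolding C1_time_C2_space_def C1_on_horizon_def time_deriv_def
  by (simp add: vector_derivative_works)

text \<open>The half logarithmic derivative of the density is the time derivative of the amplitude
  exponent, and hence the real part of that of the wave function divided by the wave function
  itself.\<close>

lemma time_deriv_wave:
  fixes \<rho> S :: "real \<Rightarrow> real^'n::finite \<Rightarrow> real"
  assumes "t0 < t1" and t: "t \<in> {t0..t1}" and pos: "0 < \<rho> t x"
    and \<rho>: "C1_time_C2_space t0 t1 \<rho>" and S: "C1_time_C2_space t0 t1 S"
  defines "w \<equiv> \<lambda>t x. complex_of_real (1/2 * ln (\<rho> t x)) + \<i> * complex_of_real (S t x)"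
  shows "time_deriv t0 t1 (\<lambda>t x. exp (w t x)) t x
    = Complex (time_deriv t0 t1 \<rho> t x / (2 * \<rho> t x)) (time_deriv t0 t1 S t x) * exp (w t x)"
proof (rule time_deriv_eq[OF assms(1) t])
  let ?F = "at t within {t0..t1}"
  have "((\<lambda>t. ln (\<rho> t x)) has_vector_derivative time_deriv t0 t1 \<rho> t x * inverse (\<rho> t x)) ?F"
    using field_vector_diff_chain_within[OF C1_time_has_derivative[OF \<rho> t]
        has_field_derivative_at_within[OF DERIV_ln[OF pos]]]
    by (simp add: o_def)
  from has_vector_derivative_mult_right[OF this, of "1/2"]
  have R: "((\<lambda>t. 1/2 * ln (\<rho> t x)) has_vector_derivative
      time_deriv t0 t1 \<rho> t x / (2 * \<rho> t x)) ?F"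
    by (simp add: field_simps)
  have "((\<lambda>t. w t x) has_vector_derivative
      of_real (time_deriv t0 t1 \<rho> t x / (2 * \<rho> t x)) + \<i> * of_real (time_deriv t0 t1 S t x)) ?F"
    unfolding w_def
    by (intro has_vector_derivative_add has_vector_derivative_mult_right R
        bounded_linear.has_vector_derivative[OF bounded_linear_of_real] C1_time_has_derivative[OF S t])
  from field_vector_diff_chain_within[OF this has_field_derivative_at_within[OF DERIV_exp]]
  show "((\<lambda>s. exp (w s x)) has_vector_derivative
      Complex (time_deriv t0 t1 \<rho> t x / (2 * \<rho> t x)) (time_deriv t0 t1 S t x) * exp (w t x)) ?F"
    by (simp add: o_def Complex_eq)
qed

section \<open>Equivalence of the optimality system and the wave equation\<close>

theorem mainTheorem2:
  fixes t0 t1 :: real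
    and \<rho>0 \<rho>1 :: "real^'n::finite \<Rightarrow> real"
    and \<rho> S R :: "real \<Rightarrow> real^'n \<Rightarrow> real"
    and \<psi> \<psi>d :: "real \<Rightarrow> real^'n \<Rightarrow> complex"
  assumes horizon: "t0 < t1"
    and \<rho>0: "prob_density \<rho>0" "finite_second_moment \<rho>0"
    and \<rho>1: "prob_density \<rho>1" "finite_second_moment \<rho>1"
    and \<rho>_pos: "\<And>t x. t \<in> {t0..t1} \<Longrightarrow> 0 < \<rho> t x"
    and \<rho>_density: "\<And>t. t \<in> {t0..t1} \<Longrightarrow> prob_density (\<rho> t)"
    and \<rho>_regular: "C1_time_C2_space t0 t1 \<rho>"
    and S_regular: "C1_time_C2_space t0 t1 S"
    and R: "R = (\<lambda>t x. 1/2 * ln (\<rho> t x))"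
    and \<psi>: "\<psi> = (\<lambda>t x. exp (complex_of_real (R t x) + \<i> * complex_of_real (S t x)))"
    and \<psi>d: "\<psi>d = (\<lambda>t x. exp (complex_of_real (R t x) - \<i> * complex_of_real (S t x)))"
  shows "bridge_optimality_system t0 t1 \<rho>0 \<rho>1 \<rho> S
    \<longleftrightarrow> schroedinger_bvp t0 t1 \<rho>0 \<rho>1 (V_SB R S) \<psi> \<psi>d"
proof -
  have equations: "time_deriv t0 t1 \<rho> t x + divergence (\<lambda>y. \<rho> t y *\<^sub>R gradient (S t) y) x
        = 1/2 * laplacian (\<rho> t) x
      \<and> time_deriv t0 t1 S t x + 1/2 * (norm (gradient (S t) x))\<^sup>2 + 1/2 * laplacian (S t) x = 0
    \<longleftrightarrow> \<i> * time_deriv t0 t1 \<psi> t x = - (1/2) * laplacian (\<psi> t) x + V_SB R S t x * \<psi> t x"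
    if t: "t \<in> {t0..t1}" for t x
  proof -
    have \<rho>2: "twice_partial (\<rho> t)" and S2: "twice_partial (S t)"
      using \<rho>_regular S_regular t
      by (blast intro: C2_space_imp_twice_partial dest: C1_time_C2_space_def[THEN iffD1])+
    have pos: "0 < \<rho> t y" for y
      using \<rho>_pos[OF t] .
    define r' where "r' = time_deriv t0 t1 \<rho> t x / (2 * \<rho> t x)"
    have Rt: "R t = (\<lambda>x. 1/2 * ln (\<rho> t x))"
      by (simp add: R)
    have R2: "twice_partial (R t)"
      unfolding Rt by (rule fokker_planck_log(1)[OF \<rho>2 S2 pos])
    have \<rho>': "time_deriv t0 t1 \<rho> t x = 2 * r' * \<rho> t x"
      using pos[of x] by (simp add: r'_def)
    have \<psi>': "time_deriv t0 t1 \<psi> t x = Complex r' (time_deriv t0 t1 S t x) * \<psi> t x"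
      unfolding \<psi> R r'_def by (rule time_deriv_wave[OF horizon t pos \<rho>_regular S_regular])
    have \<psi>t: "\<psi> t = (\<lambda>x. exp (complex_of_real (R t x) + \<i> * complex_of_real (S t x)))"
      by (simp add: \<psi>)
    show ?thesis
      unfolding \<rho>' \<psi>' fokker_planck_log(2)[OF \<rho>2 S2 pos, folded Rt]
      unfolding \<psi>t schroedinger_pointwise_iff[where R = R and S = S, OF R2 S2] ..
  qed
  have boundary: "\<psi> t x * \<psi>d t x = of_real p \<longleftrightarrow> \<rho> t x = p" if "t \<in> {t0..t1}" for t x p
  proof -
    have "\<psi> t x * \<psi>d t x = exp (of_real (ln (\<rho> t x)))"
      unfolding \<psi> \<psi>d R by (simp add: exp_add[symmetric])
    also have "\<dots> = of_real (\<rho> t x)"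
      using \<rho>_pos[OF that] by (simp add: exp_of_real)
    finally show ?thesis by simp
  qed
  have ends: "t0 \<in> {t0..t1}" "t1 \<in> {t0..t1}"
    using horizon by auto
  show ?thesis
    unfolding bridge_optimality_system_def schroedinger_bvp_def boundary[OF ends(1)] boundary[OF ends(2)]
    using equations by blast
qed

end
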